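(* Let $\Omega\subset\mathbb{C}$ be a domain, let $\nu:\Omega\to\mathbb{R}$ be a real-valued function, and let $Q:\Omega\to\mathbb{C}$ be a (continuously differentiable) complex-valued function. Then the equalities $$\frac14(\Delta-\nu)\varphi=(\partial_{\overline z}+QC)(\partial_z-QC)\varphi=(\partial_z+\overline{Q}C)(\partial_{\overline z}-\overline{Q}C)\varphi$$ are valid in $\Omega$ for every real-valued twice continuously differentiable function $\varphi$ if and only if $Q$ is a solution of the complex differential Riccati equation $$\partial_{\overline z}Q+|Q|^2=\frac{\nu}{4}\quad\text{in }\Omega.$$
   Context: Here $z=x+iy$, $\partial_{\overline z}=\frac12(\partial_x+i\partial_y)$, $\partial_z=\frac12(\partial_x-i\partial_y)$, $\Delta=\partial_x^2+\partial_y^2$. $C$ denotes the operator of complex conjugation, $C[W]=\overline{W}$; thus, e.g., $(\partial_{\overline z}+QC)W=\partial_{\overline z}W+Q\overline{W}$, and $QC\varphi = Q\varphi$ for real $\varphi$. *)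

theory Defs
  imports "HOL-Analysis.Analysis" "HOL-Library.Function_Algebras"
begin

definition partial_x :: "(complex \<Rightarrow> 'a::real_normed_vector) \<Rightarrow> complex \<Rightarrow> 'a" where
  "partial_x f z = vector_derivative (\<lambda>t::real. f (z + of_real t)) (at 0)"

definition partial_y :: "(complex \<Rightarrow> 'a::real_normed_vector) \<Rightarrow> complex \<Rightarrow> 'a" where
  "partial_y f z = vector_derivative (\<lambda>t::real. f (z + \<i> * of_real t)) (at 0)"

definition d_zbar :: "(complex \<Rightarrow> complex) \<Rightarrow> complex \<Rightarrow> complex" where
  "d_zbar f z = (1/2) * (partial_x f z + \<i> * partial_y f z)"

definition d_z :: "(complex \<Rightarrow> complex) \<Rightarrow> complex \<Rightarrow> complex" where
  "d_z f z = (1/2) * (partial_x f z - \<i> * partial_y f z)"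

definition laplacian :: "(complex \<Rightarrow> 'a::real_normed_vector) \<Rightarrow> complex \<Rightarrow> 'a" where
  "laplacian f z = partial_x (partial_x f) z + partial_y (partial_y f) z"

(* Differentiability is meant over the reals. On an open set continuity of the two
   partial derivatives is continuity of the real Frechet derivative. *)
definition C1_on :: "complex set \<Rightarrow> (complex \<Rightarrow> 'a::real_normed_vector) \<Rightarrow> bool" where
  "C1_on S f \<longleftrightarrow>
     f differentiable_on S \<and> continuous_on S (partial_x f) \<and> continuous_on S (partial_y f)"

definition C2_on :: "complex set \<Rightarrow> (complex \<Rightarrow> 'a::real_normed_vector) \<Rightarrow> bool" where
  "C2_on S f \<longleftrightarrow> C1_on S f \<and> C1_on S (partial_x f) \<and> C1_on S (partial_y f)"

(* The operator QC: conjugation followed by multiplication by Q. Sums and differences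
   such as d_zbar + mult_conj Q are the pointwise ones on operators. *)
definition mult_conj ::
  "(complex \<Rightarrow> complex) \<Rightarrow> (complex \<Rightarrow> complex) \<Rightarrow> complex \<Rightarrow> complex" where
  "mult_conj Q W = (\<lambda>z. Q z * cnj (W z))"

end

theory Submission imports Defs begin

text \<open>For real-valued \<open>\<phi>\<close> one has \<open>cnj (d_z \<phi>) = d_zbar \<phi>\<close>, so the first-order terms of both
  products cancel; by symmetry of the mixed partials the products are
  \<open>\<Delta>\<phi>/4 - R \<phi>\<close> and \<open>\<Delta>\<phi>/4 - cnj R \<phi>\<close> with \<open>R = d_zbar Q + \<bar>Q\<bar>\<^sup>2\<close>. If \<open>R = \<nu>/4\<close>, then \<open>R\<close> is real
  and all three expressions agree; conversely, the choice \<open>\<phi> = 1\<close> gives \<open>R = \<nu>/4\<close>.\<close>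

section \<open>Symmetry of second derivatives\<close>

text \<open>The mean value theorem is applied twice: first along \<open>u\<close> to the difference
  of \<open>f\<close> between two parallel edges, then along \<open>v\<close> to
  \<open>F w u\<close>. Exchanging \<open>u\<close> and \<open>v\<close> leaves the left-hand side
  unchanged, which makes the two mixed derivatives comparable.\<close>

lemma second_difference_mvt:
  fixes f :: "'a::real_normed_vector \<Rightarrow> real"
  assumes f: "\<And>w. w \<in> ball z r \<Longrightarrow> (f has_derivative F w) (at w)"
    and F: "\<And>w. w \<in> ball z r \<Longrightarrow> ((\<lambda>w. F w u) has_derivative G w) (at w)"
    and r: "norm u + norm v < r"
  shows "\<exists>p\<in>ball z r. f (z + u + v) - f (z + u) - f (z + v) + f z = G p v"
proof -
  have mem: "z + t *\<^sub>R u + s *\<^sub>R v \<in> ball z r" if "0 \<le> t" "t \<le> 1" "0 \<le> s" "s \<le> 1" for s t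
  proof -
    have "norm (t *\<^sub>R u + s *\<^sub>R v) \<le> t * norm u + s * norm v"
      using that by (intro norm_triangle_le) auto
    also have "\<dots> \<le> norm u + norm v"
      using that by (intro add_mono mult_left_le_one_le) auto
    finally show ?thesis
      using r by (simp add: dist_norm algebra_simps norm_minus_commute)
  qed
  have line_u: "((\<lambda>t. f (z + t *\<^sub>R u + s *\<^sub>R v)) has_real_derivative F (z + t *\<^sub>R u + s *\<^sub>R v) u) (at t)"
    if "0 \<le> t" "t \<le> 1" "0 \<le> s" "s \<le> 1" for s t
  proof -
    note d = f[OF mem[OF that]]
    have "((\<lambda>t. f (z + t *\<^sub>R u + s *\<^sub>R v)) has_derivative
        (\<lambda>h. F (z + t *\<^sub>R u + s *\<^sub>R v) (h *\<^sub>R u))) (at t)"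
      by (rule has_derivative_compose[where f = "\<lambda>t. z + t *\<^sub>R u + s *\<^sub>R v" and g = f, OF _ d]) (auto intro!: derivative_eq_intros)
    then show ?thesis
      using linear_scale[OF has_derivative_linear[OF d]]
      by (simp add: has_field_derivative_def mult.commute[of _ "F _ u"] mult_commute_abs)
  qed
  have line_v: "((\<lambda>s. F (z + t *\<^sub>R u + s *\<^sub>R v) u) has_real_derivative G (z + t *\<^sub>R u + s *\<^sub>R v) v) (at s)"
    if "0 \<le> t" "t \<le> 1" "0 \<le> s" "s \<le> 1" for s t
  proof -
    note d = F[OF mem[OF that]]
    have "((\<lambda>s. F (z + t *\<^sub>R u + s *\<^sub>R v) u) has_derivative
        (\<lambda>h. G (z + t *\<^sub>R u + s *\<^sub>R v) (h *\<^sub>R v))) (at s)"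
      by (rule has_derivative_compose[where f = "\<lambda>s. z + t *\<^sub>R u + s *\<^sub>R v" and g = "\<lambda>w. F w u", OF _ d]) (auto intro!: derivative_eq_intros)
    then show ?thesis
      using linear_scale[OF has_derivative_linear[OF d]]
      by (simp add: has_field_derivative_def mult.commute[of _ "G _ v"] mult_commute_abs)
  qed
  \<comment> \<open>The factors 0 and 1 stay unsimplified so that both sides are visibly values, at
    the ends of the unit interval, of the function to which \<open>MVT2\<close> applies.\<close>
  have "\<exists>t. 0 < t \<and> t < 1 \<and>
      (f (z + 1 *\<^sub>R u + 1 *\<^sub>R v) - f (z + 1 *\<^sub>R u + 0 *\<^sub>R v))
        - (f (z + 0 *\<^sub>R u + 1 *\<^sub>R v) - f (z + 0 *\<^sub>R u + 0 *\<^sub>R v))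
      = (1 - 0) * (F (z + t *\<^sub>R u + 1 *\<^sub>R v) u - F (z + t *\<^sub>R u + 0 *\<^sub>R v) u)"
    using line_u[where s = 1] line_u[where s = 0]
    by (intro MVT2) (auto intro!: DERIV_diff)
  then obtain t where t: "0 < t" "t < 1" and
    teq: "f (z + u + v) - f (z + u) - f (z + v) + f z
      = F (z + t *\<^sub>R u + 1 *\<^sub>R v) u - F (z + t *\<^sub>R u + 0 *\<^sub>R v) u"
    by (auto simp: algebra_simps)
  have "\<exists>s. 0 < s \<and> s < 1 \<and>
      F (z + t *\<^sub>R u + 1 *\<^sub>R v) u - F (z + t *\<^sub>R u + 0 *\<^sub>R v) u
      = (1 - 0) * G (z + t *\<^sub>R u + s *\<^sub>R v) v"
    using t by (intro MVT2) (auto intro!: line_v)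
  then obtain s where s: "0 < s" "s < 1" and
    "F (z + t *\<^sub>R u + 1 *\<^sub>R v) u - F (z + t *\<^sub>R u + 0 *\<^sub>R v) u = G (z + t *\<^sub>R u + s *\<^sub>R v) v"
    by auto
  with teq mem[of t s] t show ?thesis
    by (intro bexI[of _ "z + t *\<^sub>R u + s *\<^sub>R v"]) auto
qed

text \<open>Schwarz's theorem: evaluating one small second difference in both orders gives points
  \<open>p\<close> and \<open>q\<close> near \<open>z\<close> with \<open>G p v = H q u\<close>, and
  continuity of the two mixed derivatives at \<open>z\<close> carries the equality over to
  \<open>z\<close>.\<close>

lemma second_derivative_symmetric:
  fixes f :: "'a::real_normed_vector \<Rightarrow> real"
  assumes S: "open S" "z \<in> S"
    and f: "\<And>w. w \<in> S \<Longrightarrow> (f has_derivative F w) (at w)"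
    and G: "\<And>w. w \<in> S \<Longrightarrow> ((\<lambda>w. F w u) has_derivative G w) (at w)"
    and H: "\<And>w. w \<in> S \<Longrightarrow> ((\<lambda>w. F w v) has_derivative H w) (at w)"
    and cont: "isCont (\<lambda>w. G w v) z" "isCont (\<lambda>w. H w u) z"
  shows "G z v = H z u"
proof (rule ccontr)
  assume ne: "G z v \<noteq> H z u"
  \<comment> \<open>Half the gap suffices: \<open>G p v\<close> and \<open>H q u\<close> coincide
    and each lies strictly within \<open>e\<close> of its value at \<open>z\<close>, so the gap
    would be less than \<open>2 * e\<close>, which is the gap itself.\<close>
  define e where "e = \<bar>G z v - H z u\<bar> / 2"
  have e: "e > 0" using ne by (simp add: e_def)
  have "\<forall>\<^sub>F w in nhds z. dist (G w v) (G z v) < e \<and> dist (H w u) (H z u) < e \<and> w \<in> S"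
    using S e cont[unfolded isCont_def, THEN tendsto_at_iff_tendsto_nhds[THEN iffD1], THEN tendstoD]
    by (intro eventually_conj eventually_nhds_in_open) auto
  then obtain r where r: "r > 0" and
    near: "\<And>w. w \<in> ball z r \<Longrightarrow> dist (G w v) (G z v) < e \<and> dist (H w u) (H z u) < e \<and> w \<in> S"
    unfolding eventually_nhds_metric by (auto simp: dist_commute)
  \<comment> \<open>The summand 1 makes the total length of the scaled vectors strictly less than
    \<open>r\<close> and keeps the denominator positive when \<open>u\<close> and \<open>v\<close>
    both vanish.\<close>
  define h where "h = r / (norm u + norm v + 1)"
  have h: "h > 0" using r by (simp add: h_def add_nonneg_pos)
  have "h * (norm u + norm v + 1) = r"
    using add_nonneg_pos[of "norm u + norm v" 1] by (simp add: h_def)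
  then have small: "norm (h *\<^sub>R u) + norm (h *\<^sub>R v) < r" "norm (h *\<^sub>R v) + norm (h *\<^sub>R u) < r"
    using h by (auto simp: algebra_simps)
  have scale: "F w (h *\<^sub>R x) = h * F w x" if "w \<in> ball z r" for w x
    using linear_scale[OF has_derivative_linear[OF f]] near[OF that] by simp
  \<comment> \<open>Linearity of \<open>F w\<close> is known only for \<open>w\<close> in the ball,
    so the derivative is computed for \<open>h * F w x\<close> and transferred by agreement on this
    open set.\<close>
  have scaled: "((\<lambda>w. F w (h *\<^sub>R x)) has_derivative (\<lambda>k. h * K w k)) (at w)"
    if "w \<in> ball z r" "((\<lambda>w. F w x) has_derivative K w) (at w)" for w x K
    by (rule has_derivative_transform_within_open[where s = "ball z r" and f = "\<lambda>w. h * F w x"])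
      (use that scale in \<open>auto intro!: has_derivative_mult_right\<close>)
  have scaled_G: "((\<lambda>w. F w (h *\<^sub>R u)) has_derivative (\<lambda>k. h * G w k)) (at w)"
    and scaled_H: "((\<lambda>w. F w (h *\<^sub>R v)) has_derivative (\<lambda>k. h * H w k)) (at w)"
    if "w \<in> ball z r" for w
    using scaled[where x = u and K = G, OF that] scaled[where x = v and K = H, OF that] G H near[OF that]
    by blast+
  obtain p where p: "p \<in> ball z r" and
    "f (z + h *\<^sub>R u + h *\<^sub>R v) - f (z + h *\<^sub>R u) - f (z + h *\<^sub>R v) + f z = h * G p (h *\<^sub>R v)"
    using second_difference_mvt[of z r f F "h *\<^sub>R u" "\<lambda>w k. h * G w k" "h *\<^sub>R v"]
      f scaled_G small(1) near by blast
  moreover obtain q where q: "q \<in> ball z r" and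
    "f (z + h *\<^sub>R v + h *\<^sub>R u) - f (z + h *\<^sub>R v) - f (z + h *\<^sub>R u) + f z = h * H q (h *\<^sub>R u)"
    using second_difference_mvt[of z r f F "h *\<^sub>R v" "\<lambda>w k. h * H w k" "h *\<^sub>R u"]
      f scaled_H small(2) near by blast
  ultimately have "h * G p (h *\<^sub>R v) = h * H q (h *\<^sub>R u)"
    by (simp add: algebra_simps)
  then have "G p v = H q u"
    using h linear_scale[OF has_derivative_linear[OF G]] linear_scale[OF has_derivative_linear[OF H]]
      near[OF p] near[OF q] by simp
  then have "\<bar>G z v - H z u\<bar> \<le> dist (G p v) (G z v) + dist (H q u) (H z u)"
    unfolding dist_real_def by linarith
  then show False
    using near[OF p] near[OF q] by (simp add: e_def)
qed

section \<open>Partial derivatives and the real Frechet derivative\<close>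

text \<open>Chain rule along a horizontal line; real linearity turns the value of \<open>F\<close>
  at a real increment into a multiple of \<open>F 1\<close>. Together with the vertical analogue,
  this lets every later computation work with values at 1 and \<i>.\<close>

lemma partial_x_eq:
  assumes "(f has_derivative F) (at z)"
  shows "partial_x f z = F 1"
proof -
  have "((\<lambda>t::real. f (z + of_real t)) has_derivative (\<lambda>h. F (of_real h))) (at 0)"
    by (rule has_derivative_compose[where g = f]) (use assms in \<open>auto intro!: derivative_eq_intros\<close>)
  then have "((\<lambda>t::real. f (z + of_real t)) has_vector_derivative F 1) (at 0)"
    using linear_scale[OF has_derivative_linear[OF assms], of _ 1]
    by (simp add: has_vector_derivative_def scaleR_conv_of_real)
  then show ?thesis
    unfolding partial_x_def by (rule vector_derivative_at)
qed

lemma partial_y_eq: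
  assumes "(f has_derivative F) (at z)"
  shows "partial_y f z = F \<i>"
proof -
  have "((\<lambda>t::real. f (z + \<i> * of_real t)) has_derivative (\<lambda>h. F (\<i> * of_real h))) (at 0)"
    by (rule has_derivative_compose[where g = f]) (use assms in \<open>auto intro!: derivative_eq_intros\<close>)
  then have "((\<lambda>t::real. f (z + \<i> * of_real t)) has_vector_derivative F \<i>) (at 0)"
    using linear_scale[OF has_derivative_linear[OF assms], of _ \<i>]
    by (simp add: has_vector_derivative_def scaleR_conv_of_real mult.commute)
  then show ?thesis
    unfolding partial_y_def by (rule vector_derivative_at)
qed

lemma d_zbar_eq: "(f has_derivative F) (at z) \<Longrightarrow> d_zbar f z = (F 1 + \<i> * F \<i>) / 2"
  by (simp add: d_zbar_def partial_x_eq partial_y_eq)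

lemma d_z_eq: "(f has_derivative F) (at z) \<Longrightarrow> d_z f z = (F 1 - \<i> * F \<i>) / 2"
  by (simp add: d_z_def partial_x_eq partial_y_eq)

lemma C1_on_has_derivative:
  assumes "open S" "C1_on S f" "z \<in> S"
  shows "(f has_derivative frechet_derivative f (at z)) (at z)"
  using assms
  by (metis C1_on_def differentiable_on_eq_differentiable_at frechet_derivative_works)

text \<open>Schwarz's theorem for the directions 1 and \<i>. On the open set the partial derivatives
  agree with \<open>F w 1\<close> and \<open>F w \<i>\<close>, so they share their derivatives, and
  \<open>C2_on\<close> supplies the continuity of both mixed partials.\<close>

lemma C2_on_mixed_partials:
  fixes \<phi> :: "complex \<Rightarrow> real"
  assumes "open S" "C2_on S \<phi>" "z \<in> S"
  shows "partial_y (partial_x \<phi>) z = partial_x (partial_y \<phi>) z"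
proof -
  define F where "F w = frechet_derivative \<phi> (at w)" for w
  define G where "G w = frechet_derivative (partial_x \<phi>) (at w)" for w
  define H where "H w = frechet_derivative (partial_y \<phi>) (at w)" for w
  have C: "C1_on S \<phi>" "C1_on S (partial_x \<phi>)" "C1_on S (partial_y \<phi>)"
    using assms by (auto simp: C2_on_def)
  have F: "(\<phi> has_derivative F w) (at w)" if "w \<in> S" for w
    unfolding F_def by (rule C1_on_has_derivative[OF assms(1) C(1) that])
  have G': "(partial_x \<phi> has_derivative G w) (at w)" if "w \<in> S" for w
    unfolding G_def by (rule C1_on_has_derivative[OF assms(1) C(2) that])
  have H': "(partial_y \<phi> has_derivative H w) (at w)" if "w \<in> S" for w
    unfolding H_def by (rule C1_on_has_derivative[OF assms(1) C(3) that])
  have G: "((\<lambda>w. F w 1) has_derivative G w) (at w)" if "w \<in> S" for w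
    by (rule has_derivative_transform_within_open[OF G'[OF that] assms(1) that])
      (simp add: partial_x_eq[OF F])
  have H: "((\<lambda>w. F w \<i>) has_derivative H w) (at w)" if "w \<in> S" for w
    by (rule has_derivative_transform_within_open[OF H'[OF that] assms(1) that])
      (simp add: partial_y_eq[OF F])
  have "continuous_on S (\<lambda>w. G w \<i>)"
    using C(2) partial_y_eq[OF G'] by (auto simp: C1_on_def cong: continuous_on_cong)
  moreover have "continuous_on S (\<lambda>w. H w 1)"
    using C(3) partial_x_eq[OF H'] by (auto simp: C1_on_def cong: continuous_on_cong)
  ultimately have "G z \<i> = H z 1"
    using assms F G H
    by (intro second_derivative_symmetric[of S z \<phi> F 1 G \<i> H])
      (auto simp: continuous_on_eq_continuous_at)
  then show ?thesis
    using assms by (simp add: partial_x_eq[OF H'] partial_y_eq[OF G'])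
qed

section \<open>The two operator products on real functions\<close>

text \<open>Both products are computed pointwise without assuming the Riccati equation, so the
  deviation from the Schroedinger operator is recorded by \<open>R\<close> alone and each direction
  of the equivalence can be read off.\<close>

lemma factorizations_of_real:
  fixes \<phi> :: "complex \<Rightarrow> real"
  assumes S: "open S" "z \<in> S" and Q: "C1_on S Q" and \<phi>: "C2_on S \<phi>"
  defines "R \<equiv> d_zbar Q z + complex_of_real ((cmod (Q z))\<^sup>2)"
  shows "(d_zbar + mult_conj Q) ((d_z - mult_conj Q) (\<lambda>w. complex_of_real (\<phi> w))) z
      = complex_of_real (laplacian \<phi> z / 4) - R * complex_of_real (\<phi> z)"
    and "(d_z + mult_conj (\<lambda>w. cnj (Q w)))
        ((d_zbar - mult_conj (\<lambda>w. cnj (Q w))) (\<lambda>w. complex_of_real (\<phi> w))) z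
      = complex_of_real (laplacian \<phi> z / 4) - cnj R * complex_of_real (\<phi> z)"
proof -
  have C: "C1_on S \<phi>" "C1_on S (partial_x \<phi>)" "C1_on S (partial_y \<phi>)"
    using \<phi> by (auto simp: C2_on_def)
  define P where "P w = frechet_derivative \<phi> (at w)" for w
  define A where "A = frechet_derivative (partial_x \<phi>) (at z)"
  define B where "B = frechet_derivative (partial_y \<phi>) (at z)"
  define D where "D = frechet_derivative Q (at z)"
  have P: "(\<phi> has_derivative P w) (at w)" if "w \<in> S" for w
    unfolding P_def by (rule C1_on_has_derivative[OF S(1) C(1) that])
  have A: "(partial_x \<phi> has_derivative A) (at z)"
    unfolding A_def by (rule C1_on_has_derivative[OF S(1) C(2) S(2)])
  have B: "(partial_y \<phi> has_derivative B) (at z)"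
    unfolding B_def by (rule C1_on_has_derivative[OF S(1) C(3) S(2)])
  have D: "(Q has_derivative D) (at z)"
    unfolding D_def by (rule C1_on_has_derivative[OF S(1) Q S(2)])
  note Pz = P[OF S(2)]
  have of_real: "((\<lambda>w. complex_of_real (\<phi> w)) has_derivative (\<lambda>h. of_real (P w h))) (at w)"
    if "w \<in> S" for w
    using P[OF that] by (rule has_derivative_of_real)
  \<comment> \<open>The second-order part of either product is \<open>(A 1 + B \<i>) / 4\<close>
    plus or minus \<open>\<i> * (A \<i> - B 1) / 4\<close>; symmetry removes the latter.\<close>
  have mixed: "A \<i> = B 1"
    using C2_on_mixed_partials[OF S(1) \<phi> S(2)] by (simp add: partial_x_eq[OF B] partial_y_eq[OF A])
  have lap: "laplacian \<phi> z = A 1 + B \<i>"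
    by (simp add: laplacian_def partial_x_eq[OF A] partial_y_eq[OF B])
  have dz: "d_z (\<lambda>w. complex_of_real (\<phi> w)) w = (of_real (partial_x \<phi> w) - \<i> * of_real (partial_y \<phi> w)) / 2"
    and dzbar: "d_zbar (\<lambda>w. complex_of_real (\<phi> w)) w = (of_real (partial_x \<phi> w) + \<i> * of_real (partial_y \<phi> w)) / 2"
    if "w \<in> S" for w
    using that by (simp_all add: d_z_eq[OF of_real] d_zbar_eq[OF of_real] partial_x_eq[OF P] partial_y_eq[OF P])
  have R: "R = (D 1 + \<i> * D \<i>) / 2 + Q z * cnj (Q z)"
    by (simp only: R_def d_zbar_eq[OF D] complex_norm_square)

  let ?U = "(d_z - mult_conj Q) (\<lambda>w. complex_of_real (\<phi> w))"
  have U: "?U w = (of_real (partial_x \<phi> w) - \<i> * of_real (partial_y \<phi> w)) / 2 - Q w * of_real (\<phi> w)"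
    if "w \<in> S" for w
    using dz[OF that] by (simp add: mult_conj_def)
  have "((\<lambda>w. (of_real (partial_x \<phi> w) - \<i> * of_real (partial_y \<phi> w)) / 2 - Q w * of_real (\<phi> w))
      has_derivative (\<lambda>h. (of_real (A h) - \<i> * of_real (B h)) / 2
        - (Q z * of_real (P z h) + D h * of_real (\<phi> z)))) (at z)"
    by (rule derivative_eq_intros A B D Pz refl | simp)+
  \<comment> \<open>\<open>?U\<close> equals the differentiated formula only on \<open>S\<close>;
    openness of \<open>S\<close> transfers the derivative at \<open>z\<close>.\<close>
  then have dU: "(?U has_derivative (\<lambda>h. (of_real (A h) - \<i> * of_real (B h)) / 2
        - (Q z * of_real (P z h) + D h * of_real (\<phi> z)))) (at z)"
    by (rule has_derivative_transform_within_open[OF _ S]) (simp add: mult_conj_def dz)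
  have "(d_zbar + mult_conj Q) ?U z = d_zbar ?U z + Q z * cnj (?U z)"
    by (simp only: plus_fun_def mult_conj_def)
  also have "\<dots> = complex_of_real (laplacian \<phi> z / 4) - R * complex_of_real (\<phi> z)"
    \<comment> \<open>The product rule contributes
      \<open>- Q z * (P z 1 + \<i> * P z \<i>) / 2\<close>. Since \<phi> is real, conjugating its
      \<open>d_z\<close> yields its \<open>d_zbar\<close>, so \<open>Q z * cnj (?U z)\<close>
      contributes the opposite term and leaves only multiples of \<open>\<phi> z\<close>.\<close>
    unfolding d_zbar_eq[OF dU] U[OF S(2)] using mixed
    by (simp add: mult_conj_def R lap partial_x_eq[OF Pz] partial_y_eq[OF Pz] field_simps)
  finally show "(d_zbar + mult_conj Q) ?U z = complex_of_real (laplacian \<phi> z / 4) - R * complex_of_real (\<phi> z)" .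

  let ?V = "(d_zbar - mult_conj (\<lambda>w. cnj (Q w))) (\<lambda>w. complex_of_real (\<phi> w))"
  have V: "?V w = (of_real (partial_x \<phi> w) + \<i> * of_real (partial_y \<phi> w)) / 2 - cnj (Q w) * of_real (\<phi> w)"
    if "w \<in> S" for w
    using dzbar[OF that] by (simp add: mult_conj_def)
  \<comment> \<open>Conjugation is real linear, so \<open>cnj (Q w)\<close> has derivative
    \<open>cnj (D h)\<close>. Hence its \<open>d_z\<close> is the conjugate of
    \<open>d_zbar Q z\<close>, which is how \<open>cnj R\<close> arises.\<close>
  have "((\<lambda>w. (of_real (partial_x \<phi> w) + \<i> * of_real (partial_y \<phi> w)) / 2 - cnj (Q w) * of_real (\<phi> w))
      has_derivative (\<lambda>h. (of_real (A h) + \<i> * of_real (B h)) / 2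
        - (cnj (Q z) * of_real (P z h) + cnj (D h) * of_real (\<phi> z)))) (at z)"
    by (rule derivative_eq_intros A B D Pz refl | simp)+
  then have dV: "(?V has_derivative (\<lambda>h. (of_real (A h) + \<i> * of_real (B h)) / 2
        - (cnj (Q z) * of_real (P z h) + cnj (D h) * of_real (\<phi> z)))) (at z)"
    by (rule has_derivative_transform_within_open[OF _ S]) (simp add: mult_conj_def dzbar)
  have "(d_z + mult_conj (\<lambda>w. cnj (Q w))) ?V z = d_z ?V z + cnj (Q z) * cnj (?V z)"
    by (simp only: plus_fun_def mult_conj_def)
  also have "\<dots> = complex_of_real (laplacian \<phi> z / 4) - cnj R * complex_of_real (\<phi> z)"
    unfolding d_z_eq[OF dV] V[OF S(2)] using mixed
    by (simp add: mult_conj_def R lap partial_x_eq[OF Pz] partial_y_eq[OF Pz] field_simps)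
  finally show "(d_z + mult_conj (\<lambda>w. cnj (Q w))) ?V z
      = complex_of_real (laplacian \<phi> z / 4) - cnj R * complex_of_real (\<phi> z)" .
qed

section \<open>Equivalence with the Riccati equation\<close>

lemma C2_on_const: "C2_on S (\<lambda>_. c)"
proof -
  have "partial_x (\<lambda>_. d) = (\<lambda>_. 0)" "partial_y (\<lambda>_. d) = (\<lambda>_. 0)" for d :: 'a
    by (simp_all add: partial_x_def partial_y_def fun_eq_iff)
  then show ?thesis
    by (simp add: C2_on_def C1_on_def)
qed

theorem theorem8:
  fixes \<Omega> :: "complex set" and \<nu> :: "complex \<Rightarrow> real" and Q :: "complex \<Rightarrow> complex"
  assumes "open \<Omega>" and "connected \<Omega>" and "\<Omega> \<noteq> {}"
    and "C1_on \<Omega> Q"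
  shows "(\<forall>\<phi> :: complex \<Rightarrow> real. C2_on \<Omega> \<phi> \<longrightarrow>
            (\<forall>z\<in>\<Omega>.
               complex_of_real ((1/4) * (laplacian \<phi> z - \<nu> z * \<phi> z))
                 = (d_zbar + mult_conj Q) ((d_z - mult_conj Q) (\<lambda>w. complex_of_real (\<phi> w))) z
               \<and>
               (d_zbar + mult_conj Q) ((d_z - mult_conj Q) (\<lambda>w. complex_of_real (\<phi> w))) z
                 = (d_z + mult_conj (\<lambda>w. cnj (Q w)))
                     ((d_zbar - mult_conj (\<lambda>w. cnj (Q w))) (\<lambda>w. complex_of_real (\<phi> w))) z))
         \<longleftrightarrow>
         (\<forall>z\<in>\<Omega>. d_zbar Q z + complex_of_real ((cmod (Q z))\<^sup>2) = complex_of_real (\<nu> z / 4))"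
proof (intro iffI ballI allI impI)
  fix z
  assume H: "\<forall>\<phi> :: complex \<Rightarrow> real. C2_on \<Omega> \<phi> \<longrightarrow>
            (\<forall>z\<in>\<Omega>.
               complex_of_real ((1/4) * (laplacian \<phi> z - \<nu> z * \<phi> z))
                 = (d_zbar + mult_conj Q) ((d_z - mult_conj Q) (\<lambda>w. complex_of_real (\<phi> w))) z
               \<and>
               (d_zbar + mult_conj Q) ((d_z - mult_conj Q) (\<lambda>w. complex_of_real (\<phi> w))) z
                 = (d_z + mult_conj (\<lambda>w. cnj (Q w)))
                     ((d_zbar - mult_conj (\<lambda>w. cnj (Q w))) (\<lambda>w. complex_of_real (\<phi> w))) z)"
    and z: "z \<in> \<Omega>"
  let ?one = "\<lambda>_::complex. 1::real"
  define R where "R = d_zbar Q z + complex_of_real ((cmod (Q z))\<^sup>2)"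
  \<comment> \<open>The constant 1 is the test function. Its Laplacian appears identically on both
    sides and cancels without being evaluated, leaving \<open>R\<close> equal to
    \<open>\<nu> z / 4\<close>.\<close>
  have "complex_of_real ((1/4) * (laplacian ?one z - \<nu> z * 1))
      = complex_of_real (laplacian ?one z / 4) - R * complex_of_real 1"
    unfolding R_def
    by (rule trans[OF conjunct1[OF H[rule_format, OF C2_on_const z]]
          factorizations_of_real(1)[OF assms(1) z assms(4) C2_on_const]])
  then show "d_zbar Q z + complex_of_real ((cmod (Q z))\<^sup>2) = complex_of_real (\<nu> z / 4)"
    unfolding R_def[symmetric] by (simp add: diff_divide_distrib)
next
  fix \<phi> :: "complex \<Rightarrow> real" and z
  assume "\<forall>z\<in>\<Omega>. d_zbar Q z + complex_of_real ((cmod (Q z))\<^sup>2) = complex_of_real (\<nu> z / 4)"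
    and \<phi>: "C2_on \<Omega> \<phi>" and z: "z \<in> \<Omega>"
  then have "d_zbar Q z + complex_of_real ((cmod (Q z))\<^sup>2) = complex_of_real (\<nu> z / 4)"
    by blast
  \<comment> \<open>Rewriting \<open>R\<close> as the real number \<open>\<nu> z / 4\<close> makes
    the conjugate in the second identity harmless, so both right-hand sides become the same.\<close>
  note facts = factorizations_of_real[OF assms(1) z assms(4) \<phi>, unfolded this]
  show "complex_of_real ((1/4) * (laplacian \<phi> z - \<nu> z * \<phi> z))
                 = (d_zbar + mult_conj Q) ((d_z - mult_conj Q) (\<lambda>w. complex_of_real (\<phi> w))) z
               \<and>
               (d_zbar + mult_conj Q) ((d_z - mult_conj Q) (\<lambda>w. complex_of_real (\<phi> w))) z
                 = (d_z + mult_conj (\<lambda>w. cnj (Q w)))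
                     ((d_zbar - mult_conj (\<lambda>w. cnj (Q w))) (\<lambda>w. complex_of_real (\<phi> w))) z"
    unfolding facts by (simp add: field_simps)
qed

end
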